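(* Let $d\ge 1$, $T>0$, $q_T\in\mathbb{R}^d$, and let $L:\mathbb{R}^d\times\mathbb{R}^d\to\mathbb{R}$, $(q,v)\mapsto L(q,v)$, be a separable Lagrangian. Let $V:[0,T]\times\mathbb{R}^d\to\mathbb{R}$ be continuously differentiable in time and space and such that $$V(t,q) = -\min_{x\in C^2([t,T],\mathbb{R}^d)}\int_t^T L(x_s,v_s)\,ds \quad\text{subject to } x_t=q,\ x_T=q_T,$$ where $\dot x_s=v_s$ for all $s$. Then $V$ satisfies the Hamilton-Jacobi-Bellman differential equation $$\partial_t V(t,q)+H(q,\nabla V)=0,$$ where $$H(q,p)=\sup_{v}\{\langle p,v\rangle-L(q,v)\},$$ with the singular final condition $$V(T,q)=\begin{cases}0,&\text{if } q=q_T,\\ \infty,&\text{if } q\neq q_T.\end{cases}$$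
   Context: Separable means that $L(q,v)=c(v)+f(q)$, where $c:\mathbb{R}^d\to\mathbb{R}_+$ is a convex instantaneous trading-cost function and $f$ depends on the position $q$ only. $\nabla V$ denotes the gradient of $V$ with respect to the space variable $q$, $\langle\cdot,\cdot\rangle$ is the Euclidean inner product on $\mathbb{R}^d$, and the supremum defining $H$ is over $v\in\mathbb{R}^d$. The vector $q_T$ is the desired final portfolio at time $T$.
   Formalization: L is additionally assumed continuous (the equation can fail if f is discontinuous); V is extended-valued and C¹ only for t<T, as it is infinite at T; and the final value for q≠q_T is −∞ rather than the printed ∞, because V is minus the minimum over an empty set. *)

theory Defs
  imports "HOL-Analysis.Analysis"
begin

text \<open>The cost \<open>c\<close> is finite and convex on the whole space, hence continuous; no
  regularity is imposed on \<open>f\<close> here.\<close>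

definition separable_lagrangian :: "(real^'d \<Rightarrow> real^'d \<Rightarrow> real) \<Rightarrow> bool" where
  "separable_lagrangian L \<longleftrightarrow>
     (\<exists>c f. convex_on UNIV c \<and> (\<forall>v. 0 \<le> c v) \<and> (\<forall>q v. L q v = c v + f q))"

text \<open>Derivatives are taken within \<open>{a..b}\<close>, so they are one-sided at the end points.
  If \<open>a = b\<close> then \<open>v\<close> is unconstrained, which is harmless because \<open>v\<close> is
  only ever integrated over \<open>{a..b}\<close>.\<close>

definition C2_path :: "real \<Rightarrow> real \<Rightarrow> (real \<Rightarrow> real^'d) \<Rightarrow> (real \<Rightarrow> real^'d) \<Rightarrow> bool" where
  "C2_path a b x v \<longleftrightarrow>
     (\<forall>s\<in>{a..b}. (x has_vector_derivative v s) (at s within {a..b})) \<and>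
     (\<exists>w. (\<forall>s\<in>{a..b}. (v has_vector_derivative w s) (at s within {a..b})) \<and>
          continuous_on {a..b} w)"

text \<open>The costs of all admissible trajectories from \<open>q\<close> at time \<open>t\<close> to \<open>qT\<close> at
  time \<open>T\<close>. They are real numbers, embedded in \<^typ>\<open>ereal\<close> so that the infimum
  is \<open>\<infinity>\<close> when there is no admissible trajectory (\<open>t = T\<close> and \<open>q \<noteq> qT\<close>);
  its negative, the value function, is then \<open>-\<infinity>\<close>.\<close>

definition trajectory_costs ::
  "(real^'d \<Rightarrow> real^'d \<Rightarrow> real) \<Rightarrow> real \<Rightarrow> real^'d \<Rightarrow> real \<Rightarrow> real^'d \<Rightarrow> ereal set" where
  "trajectory_costs L T qT t q =
     {ereal (integral {t..T} (\<lambda>s. L (x s) (v s))) | x v.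
        C2_path t T x v \<and> x t = q \<and> x T = qT}"

definition hamiltonian :: "(real^'d \<Rightarrow> real^'d \<Rightarrow> real) \<Rightarrow> real^'d \<Rightarrow> real^'d \<Rightarrow> ereal" where
  "hamiltonian L q p = (SUP v. ereal (p \<bullet> v - L q v))"

end

theory Submission
  imports Defs
begin

text \<open>Let \<open>W\<close> be the (real) value of \<open>V\<close> before time \<open>T\<close>. Restricting an optimal trajectory
  \<open>x\<close> from \<open>(t, q)\<close> to \<open>[b, T]\<close> gives \<open>W(b, x b) - W(t, q) \<ge> \<integral> L\<close> over \<open>[t, b]\<close>. Conversely, following an
  arbitrary straight line from \<open>(t, q)\<close> until time \<open>b\<close> and then an optimal trajectory gives the
  opposite inequality along that line; the concatenation has a corner, but it can be smoothed
  to a \<open>C\<^sup>2\<close> trajectory at an arbitrarily small cost. Differentiating both inequalities at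
  \<open>b = t\<close> shows that \<open>\<partial>\<^sub>t V + \<langle>\<nabla>V, u\<rangle> - L(q, u)\<close> is at most \<open>0\<close> for every \<open>u\<close> and at least \<open>0\<close>
  for the initial velocity of the optimal trajectory.\<close>

section \<open>Trajectories of class C^2 and their concatenation\<close>

text \<open>\<open>C2_path\<close> hides the second derivative behind an existential. Here it is a
  parameter, so that two pieces can be compared to second order at a junction.\<close>

definition C2_jet ::
  "real \<Rightarrow> real \<Rightarrow> (real \<Rightarrow> 'a::real_normed_vector) \<Rightarrow> (real \<Rightarrow> 'a) \<Rightarrow> (real \<Rightarrow> 'a) \<Rightarrow> bool" where
  "C2_jet a b x v w \<longleftrightarrow>
     (\<forall>s\<in>{a..b}. (x has_vector_derivative v s) (at s within {a..b})) \<and>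
     (\<forall>s\<in>{a..b}. (v has_vector_derivative w s) (at s within {a..b})) \<and>
     continuous_on {a..b} w"

lemma C2_path_iff_jet: "C2_path a b x v \<longleftrightarrow> (\<exists>w. C2_jet a b x v w)"
  unfolding C2_path_def C2_jet_def by blast

lemma C2_jet_subset:
  assumes "C2_jet a b x v w" "{c..d} \<subseteq> {a..b}"
  shows "C2_jet c d x v w"
  using assms unfolding C2_jet_def
  by (meson continuous_on_subset has_vector_derivative_within_subset subsetD)

lemma C2_jet_continuous_on:
  assumes "C2_jet a b x v w"
  shows "continuous_on {a..b} x" "continuous_on {a..b} v"
  using assms unfolding C2_jet_def
  by (meson continuous_on_eq_continuous_within has_vector_derivative_continuous)+

lemma C2_jet_affine: "C2_jet a b (\<lambda>s. q + (s - t) *\<^sub>R u) (\<lambda>s. u) (\<lambda>s. 0)"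
  unfolding C2_jet_def by (auto intro!: derivative_eq_intros)

text \<open>The two closed intervals meet only at \<open>b\<close>. There the one-sided derivatives
  agree, and with equal values they combine into a derivative within the union.\<close>

lemma has_vector_derivative_join:
  assumes "a \<le> b" "b \<le> c" "s \<in> {a..c}"
    and f: "\<And>s. s \<in> {a..b} \<Longrightarrow> (f has_vector_derivative f' s) (at s within {a..b})"
    and g: "\<And>s. s \<in> {b..c} \<Longrightarrow> (g has_vector_derivative g' s) (at s within {b..c})"
    and eq: "f b = g b" "f' b = g' b"
  shows "((\<lambda>s. if s \<in> {a..b} then f s else g s) has_vector_derivative
    (if s \<in> {a..b} then f' s else g' s)) (at s within {a..c})"
proof (rule has_vector_derivative_If_within_closures[where T = "{b..c}"])
  have *: "{a..b} \<union> (closure {a..b} \<inter> closure {b..c}) = {a..b}"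
    "{b..c} \<union> (closure {a..b} \<inter> closure {b..c}) = {b..c}"
    using assms(1,2) by auto
  show "(f has_vector_derivative f' s)
      (at s within {a..b} \<union> (closure {a..b} \<inter> closure {b..c}))"
    if "s \<in> {a..b} \<union> (closure {a..b} \<inter> closure {b..c})"
    using that f unfolding * by blast
  show "(g has_vector_derivative g' s)
      (at s within {b..c} \<union> (closure {a..b} \<inter> closure {b..c}))"
    if "s \<in> {b..c} \<union> (closure {a..b} \<inter> closure {b..c})"
    using that g unfolding * by blast
  show "s \<in> {a..b} \<union> {b..c}" "{a..c} = {a..b} \<union> {b..c}"
    using assms(1-3) by auto
qed (use eq in \<open>auto dest: antisym\<close>)

text \<open>Contact of order two at \<open>b\<close> suffices: equal values and first derivatives
  give differentiability of the glued curve, equal first and second derivatives that of its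
  velocity, and equal second derivatives the continuity of \<open>w\<close>. Both descriptions of
  the result include the point \<open>b\<close>, so joins can be iterated.\<close>

lemma C2_jet_join:
  assumes "a \<le> b" "b \<le> c"
    and 1: "C2_jet a b x1 v1 w1" and 2: "C2_jet b c x2 v2 w2"
    and eq: "x1 b = x2 b" "v1 b = v2 b" "w1 b = w2 b"
  obtains x v w where "C2_jet a c x v w"
    "\<And>s. s \<in> {a..b} \<Longrightarrow> x s = x1 s \<and> v s = v1 s \<and> w s = w1 s"
    "\<And>s. s \<in> {b..c} \<Longrightarrow> x s = x2 s \<and> v s = v2 s \<and> w s = w2 s"
proof
  let ?j = "\<lambda>f g s. if s \<in> {a..b} then f s else g s :: 'a"
  have "continuous_on ({a..b} \<union> {b..c}) (?j w1 w2)"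
    using 1 2 eq unfolding C2_jet_def by (intro continuous_on_If) (auto dest: antisym)
  moreover have "{a..b} \<union> {b..c} = {a..c}"
    using assms(1,2) by auto
  ultimately show "C2_jet a c (?j x1 x2) (?j v1 v2) (?j w1 w2)"
    using 1 2 eq assms(1,2) has_vector_derivative_join[of a b c _ x1 v1 x2 v2]
      has_vector_derivative_join[of a b c _ v1 w1 v2 w2]
    unfolding C2_jet_def by simp
qed (use eq in \<open>auto dest: antisym\<close>)

lemma continuous_on_lagrangian:
  assumes "continuous_on UNIV (\<lambda>(q, v). L q v)" "C2_jet a b x v w"
  shows "continuous_on {a..b} (\<lambda>s. L (x s) (v s))"
  using continuous_on_compose2[OF assms(1) continuous_on_Pair[OF C2_jet_continuous_on[OF assms(2)]]]
  by simp

section \<open>A polynomial cutoff and the blending of two curves\<close>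

text \<open>The quintic from \<open>0\<close> to \<open>1\<close> whose first two derivatives vanish at both ends.\<close>

definition smoothstep :: "real \<Rightarrow> real" where
  "smoothstep r = r^3 * (10 - 15 * r + 6 * r^2)"

definition smoothstep' :: "real \<Rightarrow> real" where
  "smoothstep' r = 30 * (r^2 * (1 - r)^2)"

definition smoothstep'' :: "real \<Rightarrow> real" where
  "smoothstep'' r = 60 * r * (1 - r) * (1 - 2 * r)"

lemma smoothstep_deriv:
  assumes "(g has_real_derivative g') (at s within S)"
  shows "((\<lambda>s. smoothstep (g s)) has_real_derivative smoothstep' (g s) * g') (at s within S)"
    "((\<lambda>s. smoothstep' (g s)) has_real_derivative smoothstep'' (g s) * g') (at s within S)"
proof -
  have "(smoothstep has_real_derivative smoothstep' r) (at r)" for r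
    unfolding smoothstep_def smoothstep'_def
    by (auto intro!: derivative_eq_intros simp: algebra_simps power2_eq_square power3_eq_cube)
  then show "((\<lambda>s. smoothstep (g s)) has_real_derivative smoothstep' (g s) * g') (at s within S)"
    using assms by (rule DERIV_chain2)
  have "(smoothstep' has_real_derivative smoothstep'' r) (at r)" for r
    unfolding smoothstep'_def smoothstep''_def
    by (auto intro!: derivative_eq_intros simp: algebra_simps power2_eq_square power3_eq_cube)
  then show "((\<lambda>s. smoothstep' (g s)) has_real_derivative smoothstep'' (g s) * g') (at s within S)"
    using assms by (rule DERIV_chain2)
qed

lemma smoothstep_ends:
  "smoothstep 0 = 0" "smoothstep' 0 = 0" "smoothstep'' 0 = 0"
  "smoothstep 1 = 1" "smoothstep' 1 = 0" "smoothstep'' 1 = 0"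
  by (simp_all add: smoothstep_def smoothstep'_def smoothstep''_def)

lemma smoothstep_bounds:
  assumes "0 \<le> r" "r \<le> 1"
  shows "0 \<le> smoothstep r" "smoothstep r \<le> 1" "\<bar>smoothstep' r\<bar> \<le> 30"
proof -
  \<comment> \<open>Completing the square shows that the quadratic factor is positive.\<close>
  have "10 - 15 * r + 6 * r^2 = 6 * (r - 5/4)^2 + 5/8"
    by (simp add: power2_eq_square field_simps)
  then show "0 \<le> smoothstep r"
    using assms unfolding smoothstep_def by simp
  \<comment> \<open>This is the symmetry of the quintic: the right-hand side is
    \<open>smoothstep (1 - r)\<close>.\<close>
  have "1 - smoothstep r = (1 - r)^3 * (1 + 3 * r + 6 * r^2)"
    by (simp add: smoothstep_def power2_eq_square power3_eq_cube algebra_simps)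
  moreover have "0 \<le> (1 - r)^3 * (1 + 3 * r + 6 * r^2)"
    using assms by simp
  ultimately show "smoothstep r \<le> 1" by simp
  have "r^2 * (1 - r)^2 \<le> 1"
    using assms by (intro mult_le_one power_le_one) auto
  then show "\<bar>smoothstep' r\<bar> \<le> 30"
    by (simp add: smoothstep'_def)
qed

text \<open>By \<open>smoothstep_ends\<close> the blend has the same position, velocity and
  acceleration as \<open>l\<close> at \<open>b\<close>, and for \<open>d > 0\<close> the same as
  \<open>y\<close> at \<open>b + d\<close> when that time lies in \<open>{b..c}\<close>. The
  formulas are the product rule applied once and twice.\<close>

lemma C2_jet_blend:
  fixes d :: real
  assumes l: "C2_jet b c l l' l''" and y: "C2_jet b c y y' y''"
  defines "r \<equiv> \<lambda>s. (s - b) / d"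
  shows "C2_jet b c
    (\<lambda>s. l s + smoothstep (r s) *\<^sub>R (y s - l s))
    (\<lambda>s. l' s + smoothstep (r s) *\<^sub>R (y' s - l' s) + (smoothstep' (r s) / d) *\<^sub>R (y s - l s))
    (\<lambda>s. l'' s + smoothstep (r s) *\<^sub>R (y'' s - l'' s)
       + (2 * smoothstep' (r s) / d) *\<^sub>R (y' s - l' s) + (smoothstep'' (r s) / d^2) *\<^sub>R (y s - l s))"
proof -
  \<comment> \<open>For \<open>d = 0\<close> division by zero makes \<open>r\<close> constantly
    \<open>0\<close>, and \<open>1 / d = 0\<close> is still its derivative.\<close>
  have r: "(r has_real_derivative 1 / d) (at s within {b..c})" for s
    unfolding r_def by (cases "d = 0") (auto intro!: derivative_eq_intros)
  have "continuous_on {b..c} l''" "continuous_on {b..c} y''"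
    using l y unfolding C2_jet_def by auto
  then have "continuous_on {b..c} (\<lambda>s. l'' s + smoothstep (r s) *\<^sub>R (y'' s - l'' s)
       + (2 * smoothstep' (r s) / d) *\<^sub>R (y' s - l' s) + (smoothstep'' (r s) / d^2) *\<^sub>R (y s - l s))"
    unfolding smoothstep_def smoothstep'_def smoothstep''_def r_def divide_inverse
    by (intro continuous_intros C2_jet_continuous_on[OF l] C2_jet_continuous_on[OF y])
  moreover have "((\<lambda>s. l s + smoothstep (r s) *\<^sub>R (y s - l s)) has_vector_derivative
      l' s + smoothstep (r s) *\<^sub>R (y' s - l' s) + (smoothstep' (r s) / d) *\<^sub>R (y s - l s))
      (at s within {b..c})" if "s \<in> {b..c}" for s
  proof -
    have "(l has_vector_derivative l' s) (at s within {b..c})"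
      "(y has_vector_derivative y' s) (at s within {b..c})"
      using l y that unfolding C2_jet_def by auto
    note has_vector_derivative_add[OF this(1)
        has_vector_derivative_scaleR[OF smoothstep_deriv(1)[OF r]
          has_vector_derivative_diff[OF this(2,1)]]]
    then show ?thesis by (simp add: add.assoc)
  qed
  moreover have "((\<lambda>s. l' s + smoothstep (r s) *\<^sub>R (y' s - l' s) + (smoothstep' (r s) / d) *\<^sub>R (y s - l s))
      has_vector_derivative l'' s + smoothstep (r s) *\<^sub>R (y'' s - l'' s)
       + (2 * smoothstep' (r s) / d) *\<^sub>R (y' s - l' s) + (smoothstep'' (r s) / d^2) *\<^sub>R (y s - l s))
      (at s within {b..c})" if "s \<in> {b..c}" for s
  proof -
    have "(l has_vector_derivative l' s) (at s within {b..c})"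
      "(y has_vector_derivative y' s) (at s within {b..c})"
      "(l' has_vector_derivative l'' s) (at s within {b..c})"
      "(y' has_vector_derivative y'' s) (at s within {b..c})"
      using l y that unfolding C2_jet_def by auto
    note * = has_vector_derivative_add[OF
        has_vector_derivative_add[OF this(3)
          has_vector_derivative_scaleR[OF smoothstep_deriv(1)[OF r]
            has_vector_derivative_diff[OF this(4,3)]]]
        has_vector_derivative_scaleR[OF DERIV_cdivide[OF smoothstep_deriv(2)[OF r]]
          has_vector_derivative_diff[OF this(2,1)]]]
    \<comment> \<open>The cross term arises twice, from differentiating each of the two products in
      the velocity.\<close>
    have e: "(2 * smoothstep' (r s) / d) *\<^sub>R (y' s - l' s)
       = (smoothstep' (r s) / d) *\<^sub>R (y' s - l' s) + (smoothstep' (r s) / d) *\<^sub>R (y' s - l' s)"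
      by (simp flip: scaleR_add_left)
    show ?thesis
      by (rule has_vector_derivative_eq_rhs[OF *[of d]])
        (simp only: e power2_eq_square times_divide_eq_right mult_1_right divide_divide_eq_left
          add.assoc)
  qed
  ultimately show ?thesis
    unfolding C2_jet_def by auto
qed

section \<open>Smoothing a corner at small cost\<close>

lemma vector_derivative_bound:
  fixes f :: "real \<Rightarrow> 'a::real_normed_vector"
  assumes "\<And>s. s \<in> {a..b} \<Longrightarrow> (f has_vector_derivative f' s) (at s within {a..b})"
    and "\<And>s. s \<in> {a..b} \<Longrightarrow> norm (f' s) \<le> K" and "s \<in> {a..b}"
  shows "norm (f s - f a) \<le> K * (s - a)"
proof -
  have "norm (f s - f a) \<le> K * norm (s - a)"
  proof (rule differentiable_bound[of "{a..b}" f "\<lambda>s h. h *\<^sub>R f' s"])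
    show "onorm (\<lambda>h. h *\<^sub>R f' s) \<le> K" if "s \<in> {a..b}" for s
      using assms(2)[OF that] by (intro onorm_le) (simp add: mult.commute[of K] mult_left_mono)
  qed (use assms in \<open>auto simp: has_vector_derivative_def\<close>)
  then show ?thesis using assms(3) by simp
qed


lemma continuous_on_interval_bounded:
  fixes f :: "real \<Rightarrow> 'a::real_normed_vector"
  assumes "continuous_on {a..b} f"
  obtains K where "\<And>s. s \<in> {a..b} \<Longrightarrow> norm (f s) \<le> K"
  using compact_imp_bounded[OF compact_continuous_image[OF assms compact_Icc]]
  unfolding bounded_iff by blast

text \<open>The two pieces differ by \<open>O(s - b)\<close> near the corner, so blending them over a window of
  length \<open>d\<close> changes the velocity by \<open>O(1)\<close> and hence the cost by \<open>O(d)\<close>.\<close>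

lemma smooth_concatenation:
  fixes L :: "real^'d \<Rightarrow> real^'d \<Rightarrow> real"
  assumes L: "continuous_on UNIV (\<lambda>(q, v). L q v)"
    and "a \<le> b" "b < c"
    and l: "C2_jet a c l l' l''" and y: "C2_jet b c y y' y''"
    and eq: "l b = y b" and "0 < e"
  obtains x v where "C2_path a c x v" "x a = l a" "x c = y c"
    "integral {a..c} (\<lambda>s. L (x s) (v s))
       \<le> integral {a..b} (\<lambda>s. L (l s) (l' s)) + integral {b..c} (\<lambda>s. L (y s) (y' s)) + e"
proof -
  \<comment> \<open>The first curve continues beyond the corner up to \<open>c\<close>, so both
    curves are available on the blending window.\<close>
  have lb: "C2_jet b c l l' l''" and la: "C2_jet a b l l' l''"
    using assms(2,3) by (auto intro: C2_jet_subset[OF l])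
  \<comment> \<open>Bundling positions and velocities of both curves yields one common bound
    \<open>K\<close>.\<close>
  have "continuous_on {b..c} (\<lambda>s. ((l s, l' s), (y s, y' s)))"
    by (intro continuous_on_Pair C2_jet_continuous_on[OF lb] C2_jet_continuous_on[OF y])
  then obtain K where "\<And>s. s \<in> {b..c} \<Longrightarrow> norm ((l s, l' s), (y s, y' s)) \<le> K"
    using continuous_on_interval_bounded by blast
  then have K: "norm (l s) \<le> K" "norm (l' s) \<le> K" "norm (y s) \<le> K" "norm (y' s) \<le> K"
    if "s \<in> {b..c}" for s
    using that norm_fst_le[of "l s" "l' s"] norm_snd_le[of "l' s" "l s"]
      norm_fst_le[of "y s" "y' s"] norm_snd_le[of "y' s" "y s"]
      norm_fst_le[of "(l s, l' s)" "(y s, y' s)"] norm_snd_le[of "(y s, y' s)" "(l s, l' s)"]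
    by force+
  have K0: "0 \<le> K"
    using order_trans[OF norm_ge_zero K(1)[of b]] assms(3) by simp
  have lip: "norm (y s - l s) \<le> 2 * K * (s - b)" if "s \<in> {b..c}" for s
  proof -
    have "norm ((y s - l s) - (y b - l b)) \<le> 2 * K * (s - b)"
    proof (rule vector_derivative_bound[OF _ _ that])
      show "((\<lambda>s. y s - l s) has_vector_derivative y' s - l' s) (at s within {b..c})"
        if "s \<in> {b..c}" for s
        using y lb that unfolding C2_jet_def by (auto intro: has_vector_derivative_diff)
      show "norm (y' s - l' s) \<le> 2 * K" if "s \<in> {b..c}" for s
        using K[OF that] norm_triangle_ineq4[of "y' s" "l' s"] by linarith
    qed
    then show ?thesis using eq by simp
  qed
  \<comment> \<open>The blended velocity is bounded by
    \<open>K + 2 * K + (30 / d) * (2 * K * d) = 63 * K\<close>, and the position by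
    \<open>3 * K\<close>. Hence the bound on \<open>L\<close> does not depend on \<open>d\<close>,
    which can be chosen afterwards.\<close>
  have "compact ((\<lambda>(q, v). L q v) ` (cball 0 (63 * K) \<times> cball 0 (63 * K)))"
    by (intro compact_continuous_image compact_Times compact_cball continuous_on_subset[OF L]) simp
  from compact_imp_bounded[OF this] obtain M0 where
    M0': "\<And>z. z \<in> (\<lambda>(q, v). L q v) ` (cball 0 (63 * K) \<times> cball 0 (63 * K)) \<Longrightarrow> norm z \<le> M0"
    unfolding bounded_iff by blast
  have M0: "\<bar>L q v\<bar> \<le> M0" if "norm q \<le> 63 * K" "norm v \<le> 63 * K" for q v
    using M0'[OF image_eqI[of _ _ "(q, v)"]] that by simp
  \<comment> \<open>The maximum with \<open>1\<close> makes \<open>M\<close> positive, so that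
    \<open>e / (2 * M)\<close> is a positive length.\<close>
  define M where "M = max M0 1"
  have M: "\<bar>L q v\<bar> \<le> M" if "norm q \<le> 63 * K" "norm v \<le> 63 * K" for q v
    using M0[OF that] unfolding M_def by linarith
  have M1: "1 \<le> M" unfolding M_def by simp
  \<comment> \<open>The window must fit into \<open>{b..c}\<close>. Over it the integrals for the
    blend and for \<open>y\<close> are each at most \<open>M * d\<close> in absolute value, so their
    difference is at most \<open>e\<close>.\<close>
  define d where "d = min (c - b) (e / (2 * M))"
  have d: "0 < d" "b + d \<le> c" "2 * (M * d) \<le> e"
  proof -
    show "0 < d" "b + d \<le> c"
      using M1 assms(3,7) unfolding d_def by auto
    have "d * (2 * M) \<le> e"
      using M1 unfolding d_def by (subst pos_le_divide_eq[symmetric]) auto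
    then show "2 * (M * d) \<le> e" by (simp add: mult_ac)
  qed
  define r where "r s = (s - b) / d" for s
  define m where "m s = l s + smoothstep (r s) *\<^sub>R (y s - l s)" for s
  define m' where "m' s = l' s + smoothstep (r s) *\<^sub>R (y' s - l' s)
    + (smoothstep' (r s) / d) *\<^sub>R (y s - l s)" for s
  define m'' where "m'' s = l'' s + smoothstep (r s) *\<^sub>R (y'' s - l'' s)
    + (2 * smoothstep' (r s) / d) *\<^sub>R (y' s - l' s) + (smoothstep'' (r s) / d^2) *\<^sub>R (y s - l s)" for s
  have "C2_jet b c m m' m''"
    using C2_jet_blend[OF lb y, of d] unfolding m_def m'_def m''_def r_def .
  then have m: "C2_jet b (b + d) m m' m''"
    by (rule C2_jet_subset) (use d in auto)
  have yd: "C2_jet (b + d) c y y' y''"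
    by (rule C2_jet_subset[OF y]) (use d in auto)
  have m_b: "m b = l b" "m' b = l' b" "m'' b = l'' b"
    using eq by (simp_all add: m_def m'_def m''_def r_def smoothstep_ends)
  have m_d: "m (b + d) = y (b + d)" "m' (b + d) = y' (b + d)" "m'' (b + d) = y'' (b + d)"
    using d by (simp_all add: m_def m'_def m''_def r_def smoothstep_ends)
  obtain z z' z'' where z: "C2_jet a (b + d) z z' z''"
    and z1: "\<And>s. s \<in> {a..b} \<Longrightarrow> z s = l s \<and> z' s = l' s \<and> z'' s = l'' s"
    and z2: "\<And>s. s \<in> {b..b + d} \<Longrightarrow> z s = m s \<and> z' s = m' s \<and> z'' s = m'' s"
    by (rule C2_jet_join[OF _ _ la m]) (use assms(2) d(1) m_b in auto)
  have z_d: "z (b + d) = y (b + d)" "z' (b + d) = y' (b + d)" "z'' (b + d) = y'' (b + d)"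
    using z2[of "b + d"] m_d d by auto
  obtain x v w where x: "C2_jet a c x v w"
    and x1: "\<And>s. s \<in> {a..b + d} \<Longrightarrow> x s = z s \<and> v s = z' s \<and> w s = z'' s"
    and x2: "\<And>s. s \<in> {b + d..c} \<Longrightarrow> x s = y s \<and> v s = y' s \<and> w s = y'' s"
    by (rule C2_jet_join[OF _ d(2) z yd z_d]) (use assms(2) d(1) in auto)
  have bound: "\<bar>L (m s) (m' s)\<bar> \<le> M \<and> \<bar>L (y s) (y' s)\<bar> \<le> M" if s: "s \<in> {b..b + d}" for s
  proof -
    have sc: "s \<in> {b..c}" using s d by auto
    have r: "0 \<le> r s" "r s \<le> 1" using s d unfolding r_def by auto
    note \<sigma> = smoothstep_bounds[OF r]
    note K = K[OF sc]
    have "norm (smoothstep (r s) *\<^sub>R (y s - l s)) \<le> 1 * (2 * K)"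
      unfolding norm_scaleR using \<sigma> K norm_triangle_ineq4[of "y s" "l s"]
      by (intro mult_mono) auto
    then have 1: "norm (m s) \<le> 63 * K"
      using norm_triangle_ineq[of "l s" "smoothstep (r s) *\<^sub>R (y s - l s)"] K K0
      unfolding m_def by linarith
    have "norm (smoothstep (r s) *\<^sub>R (y' s - l' s)) \<le> 1 * (2 * K)"
      unfolding norm_scaleR using \<sigma> K norm_triangle_ineq4[of "y' s" "l' s"]
      by (intro mult_mono) auto
    \<comment> \<open>The factor \<open>1 / d\<close> from differentiating the cutoff is cancelled
      by \<open>lip\<close>, since the curves are within \<open>2 * K * d\<close> of each other on
      the window.\<close>
    moreover have "norm ((smoothstep' (r s) / d) *\<^sub>R (y s - l s)) \<le> (30 / d) * (2 * K * d)"
    proof -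
      have "norm (y s - l s) \<le> 2 * K * d"
        using lip[OF sc] mult_left_mono[of "s - b" d "2 * K"] s K0 by auto
      moreover have "\<bar>smoothstep' (r s) / d\<bar> \<le> 30 / d"
        using \<sigma>(3) d(1) by (simp add: divide_right_mono)
      ultimately show ?thesis
        unfolding norm_scaleR using d(1) by (intro mult_mono) auto
    qed
    ultimately have 2: "norm (m' s) \<le> 63 * K"
      using norm_triangle_ineq[of "l' s + smoothstep (r s) *\<^sub>R (y' s - l' s)"
          "(smoothstep' (r s) / d) *\<^sub>R (y s - l s)"]
        norm_triangle_ineq[of "l' s" "smoothstep (r s) *\<^sub>R (y' s - l' s)"] K d(1)
      unfolding m'_def by (simp add: field_simps)
    show ?thesis
      using M[OF 1 2] M[of "y s" "y' s"] K K0 by auto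
  qed
  have "C2_path a c x v"
    using x C2_path_iff_jet by blast
  moreover have "x a = l a"
    using x1[of a] z1[of a] assms(2) d(1) by auto
  moreover have "x c = y c"
    using x2[of c] d(2) by auto
  moreover have "integral {a..c} (\<lambda>s. L (x s) (v s))
      \<le> integral {a..b} (\<lambda>s. L (l s) (l' s)) + integral {b..c} (\<lambda>s. L (y s) (y' s)) + e"
  proof -
    let ?F = "\<lambda>s. L (x s) (v s)" and ?G = "\<lambda>s. L (y s) (y' s)"
    have F: "continuous_on {a..c} ?F" and G: "continuous_on {b..c} ?G"
      using continuous_on_lagrangian[OF L] x y by blast+
    \<comment> \<open>Before \<open>b\<close> and after \<open>b + d\<close> the new trajectory
      coincides with \<open>l\<close> and \<open>y\<close>; only the window contributes an
      error.\<close>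
    have "integral {a..c} ?F = integral {a..b} ?F + integral {b..b + d} ?F + integral {b + d..c} ?F"
    proof -
      have "integral {a..b + d} ?F + integral {b + d..c} ?F = integral {a..c} ?F"
        using F d assms(2) by (intro Henstock_Kurzweil_Integration.integral_combine integrable_continuous_real) auto
      moreover have "integral {a..b} ?F + integral {b..b + d} ?F = integral {a..b + d} ?F"
        using d assms(2)
        by (intro Henstock_Kurzweil_Integration.integral_combine integrable_continuous_real continuous_on_subset[OF F]) auto
      ultimately show ?thesis by simp
    qed
    moreover have "integral {b..c} ?G = integral {b..b + d} ?G + integral {b + d..c} ?G"
      using G d by (intro Henstock_Kurzweil_Integration.integral_combine[symmetric] integrable_continuous_real) auto
    moreover have "integral {a..b} ?F = integral {a..b} (\<lambda>s. L (l s) (l' s))"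
      using x1 z1 d by (intro integral_cong) auto
    moreover have "integral {b + d..c} ?F = integral {b + d..c} ?G"
      using x2 by (intro integral_cong) auto
    moreover have "\<bar>integral {b..b + d} ?F\<bar> \<le> M * d"
    proof -
      have "norm (integral {b..b + d} ?F) \<le> M * (b + d - b)"
        using bound x1 z2 d assms(2)
        by (intro integral_bound continuous_on_subset[OF F]) auto
      then show ?thesis by simp
    qed
    moreover have "\<bar>integral {b..b + d} ?G\<bar> \<le> M * d"
    proof -
      have "norm (integral {b..b + d} ?G) \<le> M * (b + d - b)"
        using bound d by (intro integral_bound continuous_on_subset[OF G]) auto
      then show ?thesis by simp
    qed
    ultimately show ?thesis using d(3) by linarith
  qed
  ultimately show thesis using that by blast
qed

section \<open>Differentiation along trajectories\<close>

text \<open>A time derivative at the point together with a jointly continuous space gradient gives a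
  total derivative on \<open>X \<times> UNIV\<close>; the chain rule along
  \<open>s \<mapsto> (s, x s)\<close> then applies.\<close>

lemma has_real_derivative_along_path:
  fixes W :: "real \<Rightarrow> 'a::real_inner \<Rightarrow> real"
  assumes time: "((\<lambda>s. W s (x t)) has_real_derivative D) (at t within X)"
    and space: "\<And>s q. s \<in> X \<Longrightarrow> GDERIV (W s) q :> G s q"
    and G: "continuous_on (X \<times> UNIV) (\<lambda>(s, q). G s q)"
    and x: "(x has_vector_derivative v) (at t within S)"
    and "S \<subseteq> X" "t \<in> S"
  shows "((\<lambda>s. W s (x s)) has_real_derivative D + G t (x t) \<bullet> v) (at t within S)"
proof -
  have "continuous_on (X \<times> UNIV) (\<lambda>p. blinfun_inner_left (case p of (s, q) \<Rightarrow> G s q))"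
    using G by (rule bounded_linear.continuous_on[OF bounded_linear_blinfun_inner_left])
  then have "continuous_on (X \<times> UNIV) (\<lambda>(s, q). blinfun_inner_left (G s q))"
    by (simp add: case_prod_unfold)
  then have "((\<lambda>(s, q). W s q) has_derivative
      (\<lambda>(h, k). D * h + blinfun_inner_left (G t (x t)) k)) (at (t, x t) within X \<times> UNIV)"
    using time space assms(5,6)
    by (intro has_derivative_partialsI)
      (auto simp: has_field_derivative_def gderiv_def continuous_on_eq_continuous_within)
  then have "((\<lambda>(s, q). W s q) has_derivative
      (\<lambda>(h, k). D * h + blinfun_inner_left (G t (x t)) k)) (at (t, x t) within (\<lambda>s. (s, x s)) ` S)"
    using assms(5) by (elim has_derivative_subset) auto
  moreover
  have "((\<lambda>s. (s, x s)) has_derivative (\<lambda>h. (h, h *\<^sub>R v))) (at t within S)"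
    using x unfolding has_vector_derivative_def by (intro has_derivative_Pair) auto
  ultimately have "((\<lambda>s. case (s, x s) of (s, q) \<Rightarrow> W s q) has_derivative
      (\<lambda>h. case (h, h *\<^sub>R v) of (h, k) \<Rightarrow> D * h + blinfun_inner_left (G t (x t)) k)) (at t within S)"
    by (rule has_derivative_in_compose[rotated])
  then have "((\<lambda>s. W s (x s)) has_derivative (\<lambda>h. D * h + (h *\<^sub>R v) \<bullet> G t (x t))) (at t within S)"
    by simp
  then show ?thesis
    unfolding has_field_derivative_def
    by (rule has_derivative_eq_rhs) (auto simp: algebra_simps inner_commute)
qed

text \<open>If \<open>D > E\<close>, then \<open>f - g\<close> has a positive right derivative and
  exceeds its value at \<open>t\<close> just after \<open>t\<close>, against
  \<open>le\<close>.\<close>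

lemma right_derivative_le:
  fixes f g :: "real \<Rightarrow> real"
  assumes f: "(f has_real_derivative D) (at t within {t..<b})"
    and g: "(g has_real_derivative E) (at t within {t..<b})" and "t < b"
    and le: "\<And>s. t < s \<Longrightarrow> s < b \<Longrightarrow> f s - f t \<le> g s - g t"
  shows "D \<le> E"
proof (rule ccontr)
  assume "\<not> D \<le> E"
  then obtain d where "0 < d" and d: "\<And>h. 0 < h \<Longrightarrow> t + h \<in> {t..<b} \<Longrightarrow> h < d \<Longrightarrow>
      f t - g t < f (t + h) - g (t + h)"
    using has_real_derivative_pos_inc_right[OF DERIV_diff[OF f g]] by auto
  define h where "h = min (b - t) d / 2"
  have "0 < h" "t + h < b" "h < d"
    using \<open>0 < d\<close> \<open>t < b\<close> unfolding h_def by (auto simp: min_def field_simps)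
  with d[of h] le[of "t + h"] show False by simp
qed

theorem theorem1:
  fixes L :: "real^'d \<Rightarrow> real^'d \<Rightarrow> real"
    and T :: real and qT :: "real^'d"
    and V :: "real \<Rightarrow> real^'d \<Rightarrow> ereal"
    and dtV :: "real \<Rightarrow> real^'d \<Rightarrow> real"
    and gradV :: "real \<Rightarrow> real^'d \<Rightarrow> real^'d"
  assumes T: "0 < T"
    and separable: "separable_lagrangian L"
    and continuous: "continuous_on UNIV (\<lambda>(q, v). L q v)"
    and value_fun: "\<And>t q. t \<in> {0..T} \<Longrightarrow> V t q = - Inf (trajectory_costs L T qT t q)"
    and min_attained: "\<And>t q. t \<in> {0..T} \<Longrightarrow> trajectory_costs L T qT t q \<noteq> {} \<Longrightarrow>
          Inf (trajectory_costs L T qT t q) \<in> trajectory_costs L T qT t q"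
    and time_deriv: "\<And>t q. t \<in> {0..<T} \<Longrightarrow>
          ((\<lambda>s. real_of_ereal (V s q)) has_real_derivative dtV t q) (at t within {0..<T})"
    and space_grad: "\<And>t q. t \<in> {0..<T} \<Longrightarrow>
          GDERIV (\<lambda>y. real_of_ereal (V t y)) q :> gradV t q"
    and time_deriv_cont: "continuous_on ({0..<T} \<times> UNIV) (\<lambda>(t, q). dtV t q)"
    and space_grad_cont: "continuous_on ({0..<T} \<times> UNIV) (\<lambda>(t, q). gradV t q)"
  shows "(\<forall>t\<in>{0..<T}. \<forall>q. ereal (dtV t q) + hamiltonian L q (gradV t q) = 0) \<and>
         (\<forall>q. V T q = (if q = qT then 0 else - \<infinity>))"
proof -
  \<comment> \<open>\<open>W\<close> serves only at times before \<open>T\<close>, where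
    \<open>V\<close> is finite; at \<open>T\<close> the conversion would turn
    \<open>-\<infinity>\<close> into \<open>0\<close>.\<close>
  define W where "W t q = real_of_ereal (V t q)" for t q
  define J where "J a b x v = integral {a..b} (\<lambda>s. L (x s) (v s))" for a b :: real and x v
  have costs: "trajectory_costs L T qT t q =
      {ereal (J t T x v) | x v. C2_path t T x v \<and> x t = q \<and> x T = qT}" for t q
    unfolding trajectory_costs_def J_def ..
  have attained: "\<exists>x v. C2_path t T x v \<and> x t = q \<and> x T = qT \<and> V t q = ereal (- J t T x v)"
    if t: "t \<in> {0..T}" "trajectory_costs L T qT t q \<noteq> {}" for t q
  proof -
    obtain x v where "Inf (trajectory_costs L T qT t q) = ereal (J t T x v)"
      "C2_path t T x v" "x t = q" "x T = qT"
      using min_attained[OF t] unfolding costs[of t q] by blast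
    then show ?thesis
      using value_fun[OF t(1), of q] by auto
  qed
  have upper: "V t q \<ge> ereal (- J t T x v)"
    if "t \<in> {0..T}" "C2_path t T x v" "x t = q" "x T = qT" for t q x v
  proof -
    have "Inf (trajectory_costs L T qT t q) \<le> ereal (J t T x v)"
      using that unfolding costs by (intro Inf_lower) blast
    then show ?thesis
      using value_fun[OF that(1), of q] by (simp add: ereal_uminus_le_reorder flip: uminus_ereal.simps)
  qed
  have reachable: "trajectory_costs L T qT t q \<noteq> {}" if "t < T \<or> q = qT" for t q
  proof -
    \<comment> \<open>The velocity of the straight line to \<open>qT\<close>. If
      \<open>t = T\<close> and \<open>q = qT\<close>, it is \<open>0\<close> and the line is
      constant.\<close>
    define u where "u = (1 / (T - t)) *\<^sub>R (qT - q)"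
    have "C2_path t T (\<lambda>s. q + (s - t) *\<^sub>R u) (\<lambda>s. u)"
      using C2_jet_affine C2_path_iff_jet by blast
    moreover have "q + (T - t) *\<^sub>R u = qT"
      using that unfolding u_def by auto
    ultimately show ?thesis unfolding costs by fastforce
  qed
  have opt: "\<exists>x v. C2_path t T x v \<and> x t = q \<and> x T = qT \<and> W t q = - J t T x v"
    if "t \<in> {0..<T}" for t q
  proof -
    have "t \<in> {0..T}" "t < T \<or> q = qT"
      using that by auto
    from attained[OF this(1) reachable[OF this(2)]] show ?thesis
      unfolding W_def by (metis real_of_ereal.simps(1))
  qed
  have W_ge: "- J t T x v \<le> W t q"
    if "t \<in> {0..<T}" "C2_path t T x v" "x t = q" "x T = qT" for t q x v
  proof -
    have t: "t \<in> {0..T}" "t < T \<or> q = qT"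
      using that(1) by auto
    obtain r where "V t q = ereal r"
      using attained[OF t(1) reachable[OF t(2)]] by blast
    with upper[OF t(1) that(2-4)] show ?thesis unfolding W_def by simp
  qed

  \<comment> \<open>Additivity of the cost, and derivatives of cost and value in the final
    time\<close>
  have J_combine: "J a b x v + J b c x v = J a c x v"
    if "C2_jet a c x v w" "a \<le> b" "b \<le> c" for a b c x v w
    using continuous_on_lagrangian[OF continuous that(1)] that(2,3) unfolding J_def
    by (intro Henstock_Kurzweil_Integration.integral_combine integrable_continuous_real)
  have J_deriv: "((\<lambda>s. J t s x v) has_real_derivative L (x t) (v t)) (at t within {t..<T})"
    if "C2_jet t T x v w" "t < T" for t x v w
    using integral_has_real_derivative[OF continuous_on_lagrangian[OF continuous that(1)], of t] that(2)
    unfolding J_def by (auto elim: DERIV_subset)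
  have W_deriv: "((\<lambda>s. W s (x s)) has_real_derivative dtV t (x t) + gradV t (x t) \<bullet> v t)
      (at t within {t..<T})"
    if "t \<in> {0..<T}" "C2_jet t T x v w" for t x v w
  proof (rule has_real_derivative_along_path[where X = "{0..<T}" and G = gradV])
    have "(x has_vector_derivative v t) (at t within {t..T})"
      using that unfolding C2_jet_def by auto
    then show "(x has_vector_derivative v t) (at t within {t..<T})"
      by (rule has_vector_derivative_within_subset) auto
  qed (use that time_deriv space_grad space_grad_cont in \<open>auto simp: W_def\<close>)
  \<comment> \<open>Dynamic programming for an arbitrary trajectory: follow \<open>x\<close> until
    \<open>b\<close>, then an optimal one from \<open>x b\<close>. The end point \<open>x T\<close>
    is free because the smoothed trajectory ends where the optimal one does.\<close>
  have dpp_ge: "W b (x b) - W t (x t) \<le> J t b x v"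
    if t: "0 \<le> t" "t < b" "b < T" and x: "C2_jet t T x v w" for t b x v w
  proof (rule field_le_epsilon)
    fix e :: real
    assume "0 < e"
    have b: "b \<in> {0..<T}" and t0: "t \<in> {0..<T}"
      using t by auto
    obtain y y' where "C2_path b T y y'" and y: "y b = x b" "y T = qT" "W b (x b) = - J b T y y'"
      using opt[OF b] by blast
    then obtain y'' where "C2_jet b T y y' y''"
      using C2_path_iff_jet by blast
    from smooth_concatenation[OF continuous less_imp_le[OF t(2)] t(3) x this y(1)[symmetric] \<open>0 < e\<close>]
    obtain z z' where "C2_path t T z z'" "z t = x t" "z T = y T"
      "J t T z z' \<le> J t b x v + J b T y y' + e"
      unfolding J_def by blast
    with W_ge[OF t0, of z z' "x t"] y show "W b (x b) - W t (x t) \<le> J t b x v + e"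
      by simp
  qed

  \<comment> \<open>The two inequalities for the Hamiltonian and the final condition\<close>
  have subsolution: "dtV t q + (gradV t q \<bullet> u - L q u) \<le> 0" if t: "t \<in> {0..<T}" for t q u
  proof -
    define l where "l s = q + (s - t) *\<^sub>R u" for s
    have l: "C2_jet t T l (\<lambda>s. u) (\<lambda>s. 0)" "l t = q"
      unfolding l_def by (auto intro: C2_jet_affine)
    have "dtV t (l t) + gradV t (l t) \<bullet> u \<le> L (l t) u"
      using t dpp_ge[OF _ _ _ l(1)] by (intro right_derivative_le[OF W_deriv[OF t l(1)] J_deriv[OF l(1)]])
        (auto simp: J_def)
    then show ?thesis using l(2) by simp
  qed
  have supersolution: "\<exists>u. 0 \<le> dtV t q + (gradV t q \<bullet> u - L q u)" if t: "t \<in> {0..<T}" for t q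
  proof -
    obtain x v where "C2_path t T x v" and x: "x t = q" "x T = qT" "W t q = - J t T x v"
      using opt[OF t] by blast
    then obtain w where w: "C2_jet t T x v w"
      using C2_path_iff_jet by blast
    have "L (x t) (v t) \<le> dtV t (x t) + gradV t (x t) \<bullet> v t"
    proof (rule right_derivative_le[OF J_deriv[OF w] W_deriv[OF t w]])
      fix b
      assume b: "t < b" "b < T"
      \<comment> \<open>The tail of the optimal trajectory is admissible from \<open>x b\<close>, so
        \<open>W b (x b)\<close> is at least minus its cost; additivity turns this into a bound on
        \<open>J t b x v\<close>.\<close>
      then have "C2_path b T x v"
        unfolding C2_path_iff_jet using C2_jet_subset[OF w, of b T] by auto
      then have "- J b T x v \<le> W b (x b)"
        using W_ge[of b x v "x b"] b t x by simp
      with J_combine[OF w, of b] b x show "J t b x v - J t t x v \<le> W b (x b) - W t (x t)"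
        by (simp add: J_def)
    qed (use t in auto)
    then show ?thesis using x(1) by (intro exI[of _ "v t"]) simp
  qed
  have "hamiltonian L q (gradV t q) = ereal (- dtV t q)" if t: "t \<in> {0..<T}" for t q
    unfolding hamiltonian_def
  proof (rule antisym)
    show "(SUP v. ereal (gradV t q \<bullet> v - L q v)) \<le> ereal (- dtV t q)"
      using subsolution[OF t, of q] by (intro SUP_least) (simp add: algebra_simps)
    obtain u where "0 \<le> dtV t q + (gradV t q \<bullet> u - L q u)"
      using supersolution[OF t] by blast
    \<comment> \<open>The initial velocity of the optimal trajectory attains the supremum.\<close>
    then show "ereal (- dtV t q) \<le> (SUP v. ereal (gradV t q \<bullet> v - L q v))"
      by (intro SUP_upper2[of u]) simp_all
  qed
  \<comment> \<open>On \<open>{T..T}\<close> every cost is \<open>0\<close>. A trajectory there has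
    a single position, so for \<open>q \<noteq> qT\<close> there is none; the infimum of the empty
    set is \<open>\<infinity>\<close>, and \<open>V\<close>, being its negative, is
    \<open>-\<infinity>\<close>.\<close>
  moreover have "V T q = (if q = qT then 0 else - \<infinity>)" for q
  proof (cases "q = qT")
    case True
    then show ?thesis
      using attained[OF _ reachable, of T q] T by (auto simp: J_def)
  next
    case False
    then have "trajectory_costs L T qT T q = {}"
      unfolding costs by auto
    then show ?thesis
      using value_fun[of T q] T False by (simp add: top_ereal_def)
  qed
  ultimately show ?thesis by auto
qed

end
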